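(* Let $q\in\mathbb{C}$ with $|q|<1$ and $x\in\mathbb{C}$. Then \[ \sum_{n\geq 0} \frac{q^{2n^2}\prod_{j=1}^n(1+2xq^{2j-1}+q^{4j-2})}{(q^2;q^2)_{2n}}= \frac{1}{(q^2;q^2)_\infty} \sum_{n\geq 0}q^{3n^2}\big(V_n(x)+V_{n-1}(x)\big). \]
   Context: $(a;q)_n=\prod_{k=0}^{n-1}(1-aq^k)$ (equal to $1$ for $n=0$), $(a;q)_\infty=\prod_{k\ge0}(1-aq^k)$. $V_n(x)$ denotes the Chebyshev polynomial of the third kind, defined by $V_0(x)=1$, $V_1(x)=2x-1$, $V_n(x)=2xV_{n-1}(x)-V_{n-2}(x)$ for $n>1$; by convention $V_n(x)=0$ for $n<0$. *)

theory Defs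
  imports "HOL-Analysis.Analysis" "HOL-Computational_Algebra.Polynomial"
begin

definition qpoch :: "complex \<Rightarrow> complex \<Rightarrow> nat \<Rightarrow> complex" where
  "qpoch a q n = (\<Prod>k<n. 1 - a * q ^ k)"

definition qpoch_inf :: "complex \<Rightarrow> complex \<Rightarrow> complex" where
  "qpoch_inf a q = (\<Prod>k. 1 - a * q ^ k)"

text \<open>The infinite product converges for \<open>norm q < 1\<close>, so the total function
  \<^const>\<open>qpoch_inf\<close> has its intended value there.\<close>

lemma convergent_prod_qpoch_inf:
  fixes a q :: complex
  assumes "norm q < 1"
  shows "convergent_prod (\<lambda>k. 1 - a * q ^ k)"
proof -
  have "summable (\<lambda>k. norm a * norm q ^ k)"
    using assms by (intro summable_mult summable_geometric) simp
  then have "summable (\<lambda>k. norm ((1 - a * q ^ k) - 1))"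
    by (simp add: norm_mult norm_power)
  then have "abs_convergent_prod (\<lambda>k. 1 - a * q ^ k)"
    by (simp add: abs_convergent_prod_conv_summable)
  then show ?thesis
    by (rule abs_convergent_prod_imp_convergent_prod)
qed

fun chebV_nat :: "nat \<Rightarrow> complex poly" where
  "chebV_nat 0 = 1"
| "chebV_nat (Suc 0) = [:-1, 2:]"
| "chebV_nat (Suc (Suc n)) = [:0, 2:] * chebV_nat (Suc n) - chebV_nat n"

text \<open>Chebyshev polynomials of the third kind, with integer index: the convention
  that they vanish at negative indices is needed for the index \<open>-1\<close>.\<close>

definition chebV :: "int \<Rightarrow> complex poly" where
  "chebV n = (if n < 0 then 0 else chebV_nat (nat n))"

end

theory Submission
  imports Defs
begin

text \<open>Write \<open>2 x = z + 1 / z\<close> and \<open>Q = q\<^sup>2\<close>. Then \<open>V\<^sub>k + V\<^sub>k\<^sub>-\<^sub>1\<close> takes the value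
  \<open>z ^ k + z ^ (-k)\<close> for \<open>k > 0\<close>, and the product on the left is
  \<open>\<Prod>j. (1 + z q ^ (2j-1)) (1 + q ^ (2j-1) / z)\<close>. The finite Jacobi triple product expands
  it into a sum over \<open>k\<close>; after interchanging summations, the inner sum over \<open>m = n - k\<close> is
  Cauchy's \<open>\<Sum>m. Q ^ (m\<^sup>2 + j m) / ((Q;Q)\<^sub>m (Q;Q)\<^sub>m\<^sub>+\<^sub>j) = 1 / (Q;Q)\<^sub>\<infinity>\<close> at \<open>j = 2 k\<close>.\<close>

section \<open>Chebyshev side: the polynomials V_k + V_(k-1)\<close>

text \<open>For k > 0 this is 2 T_k(x) with T_k the Chebyshev polynomial of the first kind; at k = 0
  it is T_0 = 1, without the factor 2.\<close>

definition chebT2 :: "complex \<Rightarrow> nat \<Rightarrow> complex" where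
  "chebT2 x k = poly (chebV (int k)) x + poly (chebV (int k - 1)) x"

lemma chebT2_0 [simp]: "chebT2 x 0 = 1"
  by (simp add: chebT2_def chebV_def)

lemma chebT2_Suc: "chebT2 x (Suc k) = poly (chebV_nat (Suc k)) x + poly (chebV_nat k) x"
  by (simp add: chebT2_def chebV_def nat_add_distrib)

lemma chebT2_1 [simp]: "chebT2 x (Suc 0) = 2 * x"
  by (simp add: chebT2_Suc)

text \<open>Kept apart from \<open>chebT2_rec\<close> because the value at index 0 is 1 and not 2:
  subtracting \<open>chebT2 x 0\<close> would be wrong here.\<close>

lemma chebT2_2: "chebT2 x (Suc (Suc 0)) = 2 * x * chebT2 x (Suc 0) - 2"
  by (simp add: chebT2_Suc algebra_simps)

lemma chebT2_rec:
  "chebT2 x (Suc (Suc (Suc k))) = 2 * x * chebT2 x (Suc (Suc k)) - chebT2 x (Suc k)"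
  by (simp add: chebT2_Suc algebra_simps)

text \<open>A crude exponential bound suffices, since it only has to lose against powers of q with
  quadratic exponents.\<close>

lemma norm_chebT2_le: "norm (chebT2 x k) \<le> (2 * norm x + 2) ^ k"
proof -
  define M where "M = 2 * norm x + 2"
  have M: "M \<ge> 2" "M \<ge> 0" by (auto simp: M_def)
  \<comment> \<open>The slack factor 2 on \<open>b\<close> admits the constant 2 subtracted in
    \<open>chebT2_2\<close>, so one estimate serves both recurrences.\<close>
  have step: "norm (2 * x * a - b) \<le> M ^ Suc (Suc k)"
    if "norm a \<le> M ^ Suc k" "norm b \<le> 2 * M ^ k" for a b :: complex and k
  proof -
    have "norm (2 * x * a - b) \<le> 2 * norm x * norm a + norm b"
      using norm_triangle_ineq4[of "2 * x * a" b] by (simp add: norm_mult)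
    also have "\<dots> \<le> 2 * norm x * M ^ Suc k + 2 * M ^ k"
      using that by (intro add_mono mult_left_mono) auto
    also have "\<dots> \<le> 2 * norm x * M ^ Suc k + 2 * M ^ Suc k"
      using M mult_right_mono[of 1 M "M ^ k"] by simp
    also have "\<dots> = M ^ Suc (Suc k)"
      by (simp add: M_def algebra_simps)
    finally show ?thesis .
  qed
  have "norm (chebT2 x k) \<le> M ^ k \<and> norm (chebT2 x (Suc k)) \<le> M ^ Suc k"
  proof (induction k)
    case 0
    then show ?case by (simp add: M_def norm_mult)
  next
    case (Suc k)
    show ?case
    proof (cases k)
      case 0
      then show ?thesis
        using Suc step[of "chebT2 x (Suc 0)" 0 2] by (simp add: chebT2_2)
    next
      case (Suc i)
      have "norm (chebT2 x (Suc i)) \<le> 2 * M ^ Suc i"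
        using Suc.IH \<open>k = Suc i\<close> M by (smt (verit) zero_le_power)
      then show ?thesis
        using Suc.IH step[of "chebT2 x (Suc (Suc i))" "Suc i" "chebT2 x (Suc i)"] \<open>k = Suc i\<close>
        by (simp add: chebT2_rec)
    qed
  qed
  then show ?thesis by (simp add: M_def)
qed

text \<open>Multiplication by 2 x is moved from the polynomials to the coefficients. The constant 2
  in \<open>chebT2_2\<close> produces \<open>2 * a 1\<close>; the last two terms come from
  truncation and vanish for coefficients supported below \<open>Suc N\<close>.\<close>

lemma sum_chebT2_mult:
  "2 * x * (\<Sum>k\<le>Suc N. chebT2 x k * a k) =
     2 * a 1 + (\<Sum>k=1..Suc N. chebT2 x k * (a (k - 1) + a (Suc k)))
     + chebT2 x (Suc (Suc N)) * a (Suc N) - chebT2 x (Suc N) * a (Suc (Suc N))"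
proof (induction N)
  case 0
  then show ?case by (simp add: chebT2_2 algebra_simps)
next
  case (Suc N)
  have "2 * x * (\<Sum>k\<le>Suc (Suc N). chebT2 x k * a k) =
      2 * x * (\<Sum>k\<le>Suc N. chebT2 x k * a k) + 2 * x * chebT2 x (Suc (Suc N)) * a (Suc (Suc N))"
    by (simp add: algebra_simps)
  then show ?case
    unfolding Suc.IH by (simp add: chebT2_rec algebra_simps)
qed

section \<open>q-Pochhammer symbols and Cauchy's identity\<close>

lemma qpoch_0 [simp]: "qpoch a q 0 = 1"
  by (simp add: qpoch_def)

lemma qpoch_Suc: "qpoch a q (Suc n) = qpoch a q n * (1 - a * q ^ n)"
  by (simp add: qpoch_def)

definition cauchy_term :: "complex \<Rightarrow> nat \<Rightarrow> nat \<Rightarrow> complex" where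
  "cauchy_term Q j m = Q ^ (m\<^sup>2 + j * m) * (1 / qpoch Q Q m) * (1 / qpoch Q Q (m + j))"

context
  fixes Q :: complex
  assumes Q: "norm Q < 1"
begin

lemma one_minus_power_neq_0: "1 - Q * Q ^ k \<noteq> 0"
proof
  assume "1 - Q * Q ^ k = 0"
  then have "norm (Q ^ Suc k) = 1" by simp
  moreover have "norm (Q ^ Suc k) < 1"
    using Q by (simp only: norm_power power_Suc_less_one norm_ge_zero)
      (metis Q norm_ge_zero power_Suc_le_self less_imp_le order_le_less_trans)
  ultimately show False by simp
qed

lemma qpoch_neq_0: "qpoch Q Q n \<noteq> 0"
  using one_minus_power_neq_0 by (simp add: qpoch_def)

lemma qpoch_inf_neq_0: "qpoch_inf Q Q \<noteq> 0"
  unfolding qpoch_inf_def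
  using convergent_prod_qpoch_inf[OF Q] one_minus_power_neq_0 by (intro prodinf_nonzero) auto

lemma qpoch_tendsto: "qpoch Q Q \<longlonglongrightarrow> qpoch_inf Q Q"
proof -
  have "(\<lambda>n. qpoch Q Q (Suc n)) \<longlonglongrightarrow> qpoch_inf Q Q"
    using convergent_prod_LIMSEQ[OF convergent_prod_qpoch_inf[OF Q]]
    by (simp add: qpoch_def qpoch_inf_def lessThan_Suc_atMost)
  then show ?thesis by (simp only: filterlim_sequentially_Suc)
qed

lemma inverse_qpoch_tendsto: "(\<lambda>n. 1 / qpoch Q Q n) \<longlonglongrightarrow> 1 / qpoch_inf Q Q"
  by (intro tendsto_intros qpoch_tendsto qpoch_inf_neq_0)

text \<open>Raising the index costs only a polynomial factor, so reciprocals with different indices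
  can be brought to common ones without clearing denominators.\<close>

lemma inverse_qpoch_Suc: "1 / qpoch Q Q n = (1 - Q ^ Suc n) * (1 / qpoch Q Q (Suc n))"
  using one_minus_power_neq_0[of n] qpoch_neq_0[of n] by (simp add: qpoch_Suc field_simps)

lemma inverse_qpoch_bounded:
  obtains B where "B > 0" "\<And>n. norm (1 / qpoch Q Q n) \<le> B"
proof -
  have "Bseq (\<lambda>n. 1 / qpoch Q Q n)"
    using inverse_qpoch_tendsto by (rule convergent_imp_Bseq[OF convergentI])
  then show ?thesis using that by (auto elim: BseqE)
qed

text \<open>The free exponent \<open>i\<close> selects the majorant: \<open>m\<close> gives
  summability uniformly in \<open>j\<close>, while \<open>j + m\<close> at index
  \<open>Suc m\<close> gives decay in \<open>j\<close>.\<close>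

lemma norm_cauchy_term_le:
  assumes "\<And>n. norm (1 / qpoch Q Q n) \<le> B" "i \<le> m\<^sup>2 + j * m"
  shows "norm (cauchy_term Q j m) \<le> B\<^sup>2 * norm Q ^ i"
proof -
  have B: "B \<ge> 0" using assms(1)[of 0] by simp
  have "norm (cauchy_term Q j m) =
      norm Q ^ (m\<^sup>2 + j * m) * norm (1 / qpoch Q Q m) * norm (1 / qpoch Q Q (m + j))"
    by (simp only: cauchy_term_def norm_mult norm_power)
  also have "\<dots> \<le> norm Q ^ i * B * B"
    using Q assms B by (intro mult_mono power_decreasing) auto
  finally show ?thesis by (simp add: power2_eq_square mult_ac)
qed

lemma summable_norm_cauchy_term: "summable (\<lambda>m. norm (cauchy_term Q j m))"
proof -
  obtain B where B: "\<And>n. norm (1 / qpoch Q Q n) \<le> B" using inverse_qpoch_bounded by blast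
  have "summable (\<lambda>m. B\<^sup>2 * norm Q ^ m)"
    using Q by (intro summable_mult summable_geometric) auto
  moreover have "norm (norm (cauchy_term Q j m)) \<le> B\<^sup>2 * norm Q ^ m" for m
    using norm_cauchy_term_le[OF B, of m m j] by (simp add: power2_eq_square trans_le_add1)
  ultimately show ?thesis by (rule summable_comparison_test'[where N = 0])
qed

lemma summable_cauchy_term: "summable (cauchy_term Q j)"
  by (rule summable_norm_cancel[OF summable_norm_cauchy_term])

text \<open>Only the term m = 0 survives as j grows: the others together are at most a constant
  times |Q|^j.\<close>

lemma suminf_cauchy_term_tendsto: "(\<lambda>j. suminf (cauchy_term Q j)) \<longlonglongrightarrow> 1 / qpoch_inf Q Q"
proof -
  obtain B where B: "\<And>n. norm (1 / qpoch Q Q n) \<le> B" using inverse_qpoch_bounded by blast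
  define K where "K = B\<^sup>2 * (\<Sum>m. norm Q ^ m)"
  have geo: "summable (\<lambda>m. norm Q ^ m)" using Q by (intro summable_geometric) auto
  have tail: "norm (\<Sum>m. cauchy_term Q j (Suc m)) \<le> norm Q ^ j * K" for j
  proof -
    have *: "norm (cauchy_term Q j (Suc m)) \<le> (B\<^sup>2 * norm Q ^ j) * norm Q ^ m" for m
      using norm_cauchy_term_le[OF B, of "j + m" "Suc m" j]
      by (simp add: power2_eq_square power_add mult_ac)
    have "norm (\<Sum>m. cauchy_term Q j (Suc m)) \<le> (\<Sum>m. (B\<^sup>2 * norm Q ^ j) * norm Q ^ m)"
      using * geo by (intro norm_suminf_le summable_mult) auto
    also have "\<dots> = norm Q ^ j * K"
      using geo by (simp add: suminf_mult K_def)
    finally show ?thesis .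
  qed
  have "(\<lambda>j. norm Q ^ j * K) \<longlonglongrightarrow> 0"
    using Q by (intro tendsto_mult_left_zero LIMSEQ_power_zero) auto
  then have "(\<lambda>j. \<Sum>m. cauchy_term Q j (Suc m)) \<longlonglongrightarrow> 0"
    by (rule Lim_null_comparison[rotated]) (use tail in auto)
  moreover have "(\<lambda>j. cauchy_term Q j 0) \<longlonglongrightarrow> 1 / qpoch_inf Q Q"
    using inverse_qpoch_tendsto by (simp add: cauchy_term_def)
  ultimately have "(\<lambda>j. (\<Sum>m. cauchy_term Q j (Suc m)) + cauchy_term Q j 0) \<longlonglongrightarrow> 0 + 1 / qpoch_inf Q Q"
    by (rule tendsto_add)
  then show ?thesis
    by (simp add: suminf_split_head[OF summable_cauchy_term])
qed

text \<open>Over common reciprocals the difference of terms carries the factor 1 - Q^(m+j+1) - Q^m =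
  (1 - Q^m) - Q^(j+1) Q^m. The second piece is a multiple of the term for j + 1. In the first, 1 -
  Q^m cancels the last factor of \<open>qpoch Q Q m\<close>, which after a shift of m leaves the
  term for j + 2.\<close>

lemma suminf_cauchy_term_rec:
  "suminf (cauchy_term Q j) - suminf (cauchy_term Q (Suc j)) =
     Q ^ Suc j * (suminf (cauchy_term Q (Suc (Suc j))) - suminf (cauchy_term Q (Suc j)))"
proof -
  define u where "u m = Q ^ (m\<^sup>2 + j * m) * (1 - Q ^ m) * (1 / qpoch Q Q m) * (1 / qpoch Q Q (m + Suc j))" for m
  have u_Suc: "u (Suc m) = Q ^ Suc j * cauchy_term Q (Suc (Suc j)) m" for m
  proof -
    have e: "(Suc m)\<^sup>2 + j * Suc m = Suc j + (m\<^sup>2 + Suc (Suc j) * m)"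
      by (simp add: power2_eq_square algebra_simps)
    have "u (Suc m) = Q ^ ((Suc m)\<^sup>2 + j * Suc m) * (1 / qpoch Q Q m) * (1 / qpoch Q Q (Suc m + Suc j))"
      unfolding u_def inverse_qpoch_Suc[of m] by (simp only: mult_ac)
    then show ?thesis
      unfolding e cauchy_term_def by (simp add: power_add mult_ac)
  qed
  \<comment> \<open>The factor 1 - Q^0 removes the initial term, so the shift of m loses
    nothing.\<close>
  have u0: "u 0 = 0" by (simp add: u_def)
  have diff: "cauchy_term Q j m - cauchy_term Q (Suc j) m = u m - Q ^ Suc j * cauchy_term Q (Suc j) m" for m
  proof -
    define r s where "r = 1 / qpoch Q Q m" and "s = 1 / qpoch Q Q (m + Suc j)"
    have s: "1 / qpoch Q Q (m + j) = (1 - Q ^ Suc (m + j)) * s"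
      using inverse_qpoch_Suc[of "m + j"] by (simp add: s_def)
    show ?thesis
      unfolding cauchy_term_def u_def s r_def[symmetric] s_def[symmetric]
      by (simp add: power_add algebra_simps)
  qed
  have "(\<lambda>m. u (Suc m)) sums (Q ^ Suc j * suminf (cauchy_term Q (Suc (Suc j))))"
    unfolding u_Suc by (intro sums_mult summable_sums summable_cauchy_term)
  then have "u sums (Q ^ Suc j * suminf (cauchy_term Q (Suc (Suc j))))"
    using sums_Suc_iff[of u] u0 by simp
  then have "(\<lambda>m. u m - Q ^ Suc j * cauchy_term Q (Suc j) m) sums
      (Q ^ Suc j * suminf (cauchy_term Q (Suc (Suc j))) - Q ^ Suc j * suminf (cauchy_term Q (Suc j)))"
    by (intro sums_diff sums_mult summable_sums summable_cauchy_term)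
  moreover have "(\<lambda>m. cauchy_term Q j m - cauchy_term Q (Suc j) m) sums
      (suminf (cauchy_term Q j) - suminf (cauchy_term Q (Suc j)))"
    by (intro sums_diff summable_sums summable_cauchy_term)
  ultimately show ?thesis
    unfolding diff right_diff_distrib by (rule sums_unique2[rotated])
qed

text \<open>By the recurrence, the consecutive differences of \<open>\<lambda>j. suminf (cauchy_term Q j)\<close> grow in
  norm with \<open>j\<close>; as the sequence converges, they all vanish.\<close>

lemma suminf_cauchy_term: "suminf (cauchy_term Q j) = 1 / qpoch_inf Q Q"
proof -
  define F where "F j = suminf (cauchy_term Q j)" for j
  define D where "D j = norm (F j - F (Suc j))" for j
  have F: "F \<longlonglongrightarrow> 1 / qpoch_inf Q Q"
    unfolding F_def by (rule suminf_cauchy_term_tendsto)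
  have "incseq D"
  proof (rule incseq_SucI)
    fix j
    have "D j = norm Q ^ Suc j * D (Suc j)"
      unfolding D_def F_def suminf_cauchy_term_rec[of j]
      by (simp only: norm_mult norm_power norm_minus_commute)
    also have "\<dots> \<le> 1 * D (Suc j)"
      using Q by (intro mult_right_mono power_le_one) (auto simp: D_def)
    finally show "D j \<le> D (Suc j)" by simp
  qed
  moreover have "D \<longlonglongrightarrow> 0"
    unfolding D_def using tendsto_norm[OF tendsto_diff[OF F LIMSEQ_Suc[OF F]]] by simp
  ultimately have "D j \<le> 0" for j by (rule incseq_le)
  then have "F (Suc j) = F j" for j by (simp add: D_def)
  then have "F j = F 0" for j by (induction j) auto
  then have "F = (\<lambda>_. F 0)" by auto
  with F have "F 0 = 1 / qpoch_inf Q Q"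
    by (metis LIMSEQ_const_iff)
  with \<open>F j = F 0\<close> show ?thesis by (simp add: F_def)
qed

lemma cauchy_term_sums: "cauchy_term Q j sums (1 / qpoch_inf Q Q)"
  using summable_sums[OF summable_cauchy_term] by (simp add: suminf_cauchy_term)

end

section \<open>Quadratic exponents and the double series\<close>

text \<open>The term is the k-th power of \<open>p ^ k * M\<close>, whose base tends to 0;
  comparison with a geometric series follows.\<close>

lemma summable_power_square_mult_power:
  fixes p M :: real
  assumes "0 \<le> p" "p < 1" "0 \<le> M"
  shows "summable (\<lambda>k. p ^ k\<^sup>2 * M ^ k)"
proof -
  have "(\<lambda>k. p ^ k * M) \<longlonglongrightarrow> 0"
    using assms by (intro tendsto_mult_left_zero LIMSEQ_power_zero) auto
  then have "\<forall>\<^sub>F k in sequentially. p ^ k * M < 1 / 2"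
    by (rule order_tendstoD) simp
  then have "\<forall>\<^sub>F k in sequentially. norm (p ^ k\<^sup>2 * M ^ k) \<le> (1 / 2) ^ k"
  proof eventually_elim
    case (elim k)
    have "p ^ k\<^sup>2 * M ^ k = (p ^ k * M) ^ k"
      by (simp add: power_mult_distrib power2_eq_square power_mult)
    also have "\<dots> \<le> (1 / 2) ^ k"
      using elim assms by (intro power_mono) auto
    finally show ?case using assms by simp
  qed
  then show ?thesis
    by (rule summable_comparison_test_ev) (intro summable_geometric, simp)
qed

text \<open>The second index is m = n - k: rows (fixed k) will give the theta series, antidiagonals
  k + m = n the summands of the left-hand side.\<close>

definition double_term :: "complex \<Rightarrow> complex \<Rightarrow> nat \<times> nat \<Rightarrow> complex" where
  "double_term q x = (\<lambda>(k, m). q ^ (3 * k\<^sup>2) * chebT2 x k * cauchy_term (q\<^sup>2) (2 * k) m)"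

section \<open>Finite Jacobi triple product\<close>

text \<open>This is q^(k^2) times the Gaussian binomial (2n choose n-k) in base q^2, divided by
  (q^2;q^2)_(2n). The explicit 0 guards against truncated subtraction in
  \<open>n - k\<close>.\<close>

definition jtp_coeff :: "complex \<Rightarrow> nat \<Rightarrow> nat \<Rightarrow> complex" where
  "jtp_coeff q n k = (if k \<le> n then
     q ^ k\<^sup>2 * (1 / qpoch (q\<^sup>2) (q\<^sup>2) (n - k)) * (1 / qpoch (q\<^sup>2) (q\<^sup>2) (n + k)) else 0)"

context
  fixes q :: complex
  assumes q: "norm q < 1"
begin

lemma norm_square_less_1: "norm (q\<^sup>2) < 1"
  using q by (simp add: norm_power power_less_one_iff abs_square_less_1)

lemma inverse_qpoch_square_Suc:
  "1 / qpoch (q\<^sup>2) (q\<^sup>2) i = (1 - q\<^sup>2 * q ^ (2 * i)) * (1 / qpoch (q\<^sup>2) (q\<^sup>2) (Suc i))"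
  using inverse_qpoch_Suc[OF norm_square_less_1, of i] by (simp add: power_mult)

text \<open>This and the next two lemmas express the level n coefficients around an index as
  polynomial multiples of the level n + 1 coefficient there, turning the recurrence into a
  polynomial identity.\<close>

lemma jtp_coeff_Suc_left:
  assumes "k \<le> n"
  shows "jtp_coeff q n k =
    (1 - q\<^sup>2 * q ^ (2 * (n - k))) * (1 - q\<^sup>2 * q ^ (2 * (n + k))) * jtp_coeff q (Suc n) k"
proof -
  from inverse_qpoch_square_Suc[of "n - k"] inverse_qpoch_square_Suc[of "n + k"] assms show ?thesis
    by (simp add: jtp_coeff_def Suc_diff_le)
qed

lemma jtp_coeff_Suc_right:
  assumes "k \<le> n"
  shows "q ^ (2 * n + 1) * jtp_coeff q n (Suc k) =
    q\<^sup>2 * q ^ (2 * (n + k)) * (1 - q\<^sup>2 * q ^ (2 * (n - k))) * (1 - q ^ (2 * (n - k)))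
      * jtp_coeff q (Suc n) k"
proof (cases "k = n")
  case True
  \<comment> \<open>The coefficient on the left is out of range, and on the right the factor 1 -
    q^(2(n-k)) is 0.\<close>
  then show ?thesis by (simp add: jtp_coeff_def)
next
  case False
  then obtain d where n: "n = Suc (k + d)"
    using assms by (metis le_neq_implies_less less_iff_Suc_add)
  define W where "W = 1 / qpoch (q\<^sup>2) (q\<^sup>2) (Suc (Suc d))"
  define Z where "Z = 1 / qpoch (q\<^sup>2) (q\<^sup>2) (Suc (Suc (k + d + k)))"
  have d: "1 / qpoch (q\<^sup>2) (q\<^sup>2) d = (1 - q\<^sup>2 * q ^ (2 * d)) * ((1 - q\<^sup>2 * q ^ (2 * Suc d)) * W)"
    unfolding W_def using inverse_qpoch_square_Suc[of d] inverse_qpoch_square_Suc[of "Suc d"] by simp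
  have e: "q ^ (2 * n + 1) * q ^ (Suc k)\<^sup>2 = q\<^sup>2 * q ^ (2 * (n + k)) * q ^ k\<^sup>2"
    unfolding power_add[symmetric] by (rule arg_cong[of _ _ "power q"]) (simp add: power2_eq_square)
  have "q ^ (2 * n + 1) * jtp_coeff q n (Suc k) =
      (q ^ (2 * n + 1) * q ^ (Suc k)\<^sup>2) * (1 / qpoch (q\<^sup>2) (q\<^sup>2) d) * Z"
    by (simp add: jtp_coeff_def n Z_def mult_2)
  also have "\<dots> = q\<^sup>2 * q ^ (2 * (n + k)) * (1 - q\<^sup>2 * q ^ (2 * (n - k))) * (1 - q ^ (2 * (n - k)))
      * (q ^ k\<^sup>2 * W * Z)"
    unfolding e d by (simp add: n power2_eq_square mult_ac)
  also have "q ^ k\<^sup>2 * W * Z = jtp_coeff q (Suc n) k"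
    by (simp add: jtp_coeff_def n W_def Z_def mult_2 Suc_diff_le)
  finally show ?thesis .
qed

text \<open>The mirror image of \<open>jtp_coeff_Suc_right\<close> under k -> -k, taken at index
  \<open>Suc k\<close>.\<close>

lemma jtp_coeff_Suc_pred:
  assumes "Suc k \<le> n"
  shows "q ^ (2 * n + 1) * jtp_coeff q n k =
    q\<^sup>2 * q ^ (2 * (n - Suc k)) * (1 - q\<^sup>2 * q ^ (2 * (n + Suc k))) * (1 - q ^ (2 * (n + Suc k)))
      * jtp_coeff q (Suc n) (Suc k)"
proof -
  obtain d where n: "n = Suc (k + d)"
    using assms by (metis Suc_le_eq less_iff_Suc_add)
  define W where "W = 1 / qpoch (q\<^sup>2) (q\<^sup>2) (Suc d)"
  define Z where "Z = 1 / qpoch (q\<^sup>2) (q\<^sup>2) (Suc (Suc (n + k)))"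
  have d: "1 / qpoch (q\<^sup>2) (q\<^sup>2) (n + k) =
      (1 - q\<^sup>2 * q ^ (2 * (n + k))) * ((1 - q\<^sup>2 * q ^ (2 * Suc (n + k))) * Z)"
    unfolding Z_def using inverse_qpoch_square_Suc[of "n + k"] inverse_qpoch_square_Suc[of "Suc (n + k)"] by simp
  have e: "q ^ (2 * n + 1) * q ^ k\<^sup>2 = q\<^sup>2 * q ^ (2 * (n - Suc k)) * q ^ (Suc k)\<^sup>2"
    unfolding power_add[symmetric] by (rule arg_cong[of _ _ "power q"]) (simp add: power2_eq_square n)
  have "q ^ (2 * n + 1) * jtp_coeff q n k =
      (q ^ (2 * n + 1) * q ^ k\<^sup>2) * W * (1 / qpoch (q\<^sup>2) (q\<^sup>2) (n + k))"
    by (simp add: jtp_coeff_def n W_def Suc_diff_le)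
  also have "\<dots> = q\<^sup>2 * q ^ (2 * (n - Suc k)) * (1 - q\<^sup>2 * q ^ (2 * (n + Suc k)))
      * (1 - q ^ (2 * (n + Suc k))) * (q ^ (Suc k)\<^sup>2 * W * Z)"
    unfolding e d by (simp add: power2_eq_square mult_ac)
  also have "q ^ (Suc k)\<^sup>2 * W * Z = jtp_coeff q (Suc n) (Suc k)"
    by (simp add: jtp_coeff_def n W_def Z_def Suc_diff_le)
  finally show ?thesis .
qed

text \<open>Since q^(2(n-k)) q^(2(n+k)) = q^(4n), the prefactors of the recurrence are polynomials
  in the same quantities as the coefficient ratios.\<close>

lemma power_4n:
  assumes "k \<le> n"
  shows "q ^ (4 * n + 2) = q\<^sup>2 * q ^ (2 * (n - k)) * q ^ (2 * (n + k))"
    and "q ^ (4 * n + 4) = q\<^sup>2 * q\<^sup>2 * q ^ (2 * (n - k)) * q ^ (2 * (n + k))"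
proof -
  obtain d where "n = k + d" using assms by (metis le_iff_add)
  then show "q ^ (4 * n + 2) = q\<^sup>2 * q ^ (2 * (n - k)) * q ^ (2 * (n + k))"
    and "q ^ (4 * n + 4) = q\<^sup>2 * q\<^sup>2 * q ^ (2 * (n - k)) * q ^ (2 * (n + k))"
    by (simp_all add: ac_simps flip: power_add)
qed

text \<open>At k = 0 the neighbours k = 1 and k = -1 coincide by symmetry, whence the factor 2,
  matching \<open>2 * a 1\<close> in \<open>sum_chebT2_mult\<close>.\<close>

lemma jtp_coeff_rec_0:
  "(1 - q ^ (4 * n + 2)) * (1 - q ^ (4 * n + 4)) * jtp_coeff q (Suc n) 0 =
     (1 + q ^ (4 * n + 2)) * jtp_coeff q n 0 + q ^ (2 * n + 1) * (2 * jtp_coeff q n 1)"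
proof -
  define y where "y = q ^ (2 * n)"
  have 1: "jtp_coeff q n 0 = (1 - q\<^sup>2 * y) * (1 - q\<^sup>2 * y) * jtp_coeff q (Suc n) 0"
    using jtp_coeff_Suc_left[of 0 n] by (simp add: y_def)
  have 2: "q ^ (2 * n + 1) * (2 * jtp_coeff q n 1) =
      2 * (q\<^sup>2 * y * (1 - q\<^sup>2 * y) * (1 - y) * jtp_coeff q (Suc n) 0)"
    using jtp_coeff_Suc_right[of 0 n] by (simp add: y_def)
  have 3: "q ^ (4 * n + 2) = q\<^sup>2 * y * y" "q ^ (4 * n + 4) = q\<^sup>2 * q\<^sup>2 * y * y"
    using power_4n[of 0 n] by (simp_all add: y_def)
  show ?thesis unfolding 1 2 3 by algebra
qed

lemma jtp_coeff_rec_Suc: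
  "(1 - q ^ (4 * n + 2)) * (1 - q ^ (4 * n + 4)) * jtp_coeff q (Suc n) (Suc k) =
     (1 + q ^ (4 * n + 2)) * jtp_coeff q n (Suc k)
     + q ^ (2 * n + 1) * (jtp_coeff q n k + jtp_coeff q n (Suc (Suc k)))"
proof (cases "Suc k \<le> n")
  case True
  define y where "y = q ^ (2 * (n - Suc k))"
  define z where "z = q ^ (2 * (n + Suc k))"
  note 1 = jtp_coeff_Suc_left[OF True, folded y_def z_def]
  have 2: "q ^ (2 * n + 1) * (jtp_coeff q n k + jtp_coeff q n (Suc (Suc k))) =
      q\<^sup>2 * y * (1 - q\<^sup>2 * z) * (1 - z) * jtp_coeff q (Suc n) (Suc k)
      + q\<^sup>2 * z * (1 - q\<^sup>2 * y) * (1 - y) * jtp_coeff q (Suc n) (Suc k)"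
    using jtp_coeff_Suc_pred[OF True, folded y_def z_def]
      jtp_coeff_Suc_right[OF True, folded y_def z_def] by (simp only: distrib_left)
  note 3 = power_4n[OF True, folded y_def z_def]
  show ?thesis unfolding 1 2 3 by algebra
next
  case False
  show ?thesis
  proof (cases "k = n")
    case True
    \<comment> \<open>At the new top index only the predecessor contributes, and (n+1)^2 = (2n+1) +
      n^2 matches the powers of q.\<close>
    define Z where "Z = 1 / qpoch (q\<^sup>2) (q\<^sup>2) (Suc (Suc (2 * n)))"
    have e': "q ^ (4 * n + 2) = q\<^sup>2 * q ^ (2 * (2 * n))" "q ^ (4 * n + 4) = q\<^sup>2 * q ^ (2 * Suc (2 * n))"
      by (simp_all add: power_add power2_eq_square power4_eq_xxxx)
    have d: "1 / qpoch (q\<^sup>2) (q\<^sup>2) (2 * n) = (1 - q ^ (4 * n + 2)) * ((1 - q ^ (4 * n + 4)) * Z)"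
      unfolding Z_def e' using inverse_qpoch_square_Suc[of "2 * n"] inverse_qpoch_square_Suc[of "Suc (2 * n)"] by simp
    have e: "q ^ (Suc n)\<^sup>2 = q ^ (2 * n + 1) * q ^ n\<^sup>2"
      unfolding power_add[symmetric] by (rule arg_cong[of _ _ "power q"]) (simp add: power2_eq_square)
    have "jtp_coeff q n n = q ^ n\<^sup>2 * (1 / qpoch (q\<^sup>2) (q\<^sup>2) (2 * n))"
      by (simp add: jtp_coeff_def mult_2)
    moreover have "jtp_coeff q (Suc n) (Suc n) = q ^ (2 * n + 1) * q ^ n\<^sup>2 * Z"
      using e by (simp add: jtp_coeff_def Z_def mult_2)
    moreover have "jtp_coeff q n (Suc n) = 0" "jtp_coeff q n (Suc (Suc n)) = 0"
      by (simp_all add: jtp_coeff_def)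
    ultimately show ?thesis
      unfolding True d by (simp add: mult_ac)
  qed (use False in \<open>simp add: jtp_coeff_def\<close>)
qed

text \<open>Induction on n, without ever solving 2 x = z + 1/z: the new factor 1 + 2 x q^(2n+1) +
  q^(4n+2) acts on the coefficients through \<open>sum_chebT2_mult\<close>, exactly as the
  coefficient recurrence prescribes.\<close>

lemma finite_jacobi_triple_product:
  "(\<Prod>j=1..n. 1 + 2 * x * q ^ (2 * j - 1) + q ^ (4 * j - 2)) / qpoch (q\<^sup>2) (q\<^sup>2) (2 * n) =
     (\<Sum>k\<le>n. chebT2 x k * jtp_coeff q n k)"
proof (induction n)
  case 0
  then show ?case by (simp add: jtp_coeff_def)
next
  case (Suc n)
  define a where "a = jtp_coeff q n"
  \<comment> \<open>The quotient of (q^2;q^2)_(2n+2) by (q^2;q^2)_(2n).\<close>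
  define c where "c = (1 - q ^ (4 * n + 2)) * (1 - q ^ (4 * n + 4))"
  \<comment> \<open>Permits padding the sum to \<open>Suc n\<close> and removes the truncation terms
    of \<open>sum_chebT2_mult\<close>.\<close>
  have a_0: "a k = 0" if "k > n" for k
    using that by (simp add: a_def jtp_coeff_def)
  have pad: "(\<Sum>k\<le>Suc n. chebT2 x k * a k) = (\<Sum>k\<le>n. chebT2 x k * a k)"
    by (simp add: a_0)
  have split: "(\<Sum>k\<le>Suc n. f k) = f 0 + (\<Sum>k=1..Suc n. f k)" for f :: "nat \<Rightarrow> complex"
    using sum.atLeast_Suc_atMost[of 0 "Suc n" f] by (simp only: atMost_atLeast0 One_nat_def le0)
  have "c * (\<Sum>k\<le>Suc n. chebT2 x k * jtp_coeff q (Suc n) k) =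
      c * jtp_coeff q (Suc n) 0 + (\<Sum>k=1..Suc n. chebT2 x k * (c * jtp_coeff q (Suc n) k))"
    unfolding split by (simp add: distrib_left sum_distrib_left mult_ac)
  also have "(\<Sum>k=1..Suc n. chebT2 x k * (c * jtp_coeff q (Suc n) k)) =
      (\<Sum>k=1..Suc n. (1 + q ^ (4 * n + 2)) * (chebT2 x k * a k)
        + q ^ (2 * n + 1) * (chebT2 x k * (a (k - 1) + a (Suc k))))"
  proof (rule sum.cong, rule refl)
    fix k assume "k \<in> {1..Suc n}"
    then obtain i where i: "k = Suc i" by (cases k) auto
    show "chebT2 x k * (c * jtp_coeff q (Suc n) k) = (1 + q ^ (4 * n + 2)) * (chebT2 x k * a k)
        + q ^ (2 * n + 1) * (chebT2 x k * (a (k - 1) + a (Suc k)))"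
      unfolding i c_def jtp_coeff_rec_Suc a_def by (simp add: algebra_simps)
  qed
  also have "c * jtp_coeff q (Suc n) 0 = (1 + q ^ (4 * n + 2)) * a 0 + q ^ (2 * n + 1) * (2 * a 1)"
    unfolding c_def jtp_coeff_rec_0 a_def ..
  also have "(1 + q ^ (4 * n + 2)) * a 0 + q ^ (2 * n + 1) * (2 * a 1) +
      (\<Sum>k=1..Suc n. (1 + q ^ (4 * n + 2)) * (chebT2 x k * a k)
        + q ^ (2 * n + 1) * (chebT2 x k * (a (k - 1) + a (Suc k)))) =
      (1 + q ^ (4 * n + 2)) * (\<Sum>k\<le>Suc n. chebT2 x k * a k)
      + q ^ (2 * n + 1) * (2 * a 1 + (\<Sum>k=1..Suc n. chebT2 x k * (a (k - 1) + a (Suc k))))"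
    unfolding split sum.distrib sum_distrib_left[symmetric] by (simp add: distrib_left)
  also have "2 * a 1 + (\<Sum>k=1..Suc n. chebT2 x k * (a (k - 1) + a (Suc k))) =
      2 * x * (\<Sum>k\<le>Suc n. chebT2 x k * a k)"
    unfolding sum_chebT2_mult by (simp add: a_0)
  finally have key: "c * (\<Sum>k\<le>Suc n. chebT2 x k * jtp_coeff q (Suc n) k) =
      (1 + 2 * x * q ^ (2 * n + 1) + q ^ (4 * n + 2)) * (\<Sum>k\<le>n. chebT2 x k * a k)"
    unfolding pad by (simp add: algebra_simps)
  have qp: "qpoch (q\<^sup>2) (q\<^sup>2) (2 * Suc n) = qpoch (q\<^sup>2) (q\<^sup>2) (2 * n) * c"
  proof -
    have "q\<^sup>2 * (q\<^sup>2) ^ (2 * n) = q ^ (4 * n + 2)" "q\<^sup>2 * (q\<^sup>2) ^ Suc (2 * n) = q ^ (4 * n + 4)"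
      by (simp_all add: power_add power_mult power_mult_distrib power2_eq_square power4_eq_xxxx mult_ac)
    then show ?thesis by (simp add: qpoch_Suc c_def del: power_Suc)
  qed
  then have c: "c \<noteq> 0"
    using qpoch_neq_0[OF norm_square_less_1, of "2 * Suc n"] by auto
  have "(\<Prod>j=1..Suc n. 1 + 2 * x * q ^ (2 * j - 1) + q ^ (4 * j - 2)) / qpoch (q\<^sup>2) (q\<^sup>2) (2 * Suc n) =
      (\<Prod>j=1..n. 1 + 2 * x * q ^ (2 * j - 1) + q ^ (4 * j - 2)) / qpoch (q\<^sup>2) (q\<^sup>2) (2 * n) *
      (1 + 2 * x * q ^ (2 * n + 1) + q ^ (4 * n + 2)) / c"
    unfolding qp by simp
  also have "\<dots> = (\<Sum>k\<le>Suc n. chebT2 x k * jtp_coeff q (Suc n) k)"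
    unfolding Suc.IH using key c by (simp add: a_def field_simps)
  finally show ?case .
qed

section \<open>Summing the double series in two ways\<close>

lemma summable_norm_theta: "summable (\<lambda>k. norm (q ^ (3 * k\<^sup>2) * chebT2 x k))"
proof -
  have "norm q ^ 3 < 1" using q by (simp add: power_less_one_iff)
  then have "summable (\<lambda>k. (norm q ^ 3) ^ k\<^sup>2 * (2 * norm x + 2) ^ k)"
    by (intro summable_power_square_mult_power) auto
  then show ?thesis
    by (rule summable_comparison_test'[where N = 0])
      (use norm_chebT2_le in \<open>simp add: norm_mult norm_power power_mult mult_left_mono\<close>)
qed

text \<open>Justifies the interchange of summations. Dropping the mixed exponent 2 k m leaves a
  majorant that is a product of a summable function of k and one of m.\<close>

lemma abs_summable_double_term: "(\<lambda>p. norm (double_term q x p)) summable_on (UNIV \<times> UNIV)"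
proof -
  obtain B where B: "\<And>n. norm (1 / qpoch (q\<^sup>2) (q\<^sup>2) n) \<le> B"
    using inverse_qpoch_bounded[OF norm_square_less_1] by blast
  define u where "u k = norm (q ^ (3 * k\<^sup>2) * chebT2 x k)" for k
  define v where "v m = B\<^sup>2 * norm (q\<^sup>2) ^ m" for m
  have u: "u summable_on UNIV"
    unfolding u_def using summable_norm_theta by (subst summable_on_UNIV_nonneg_real_iff) auto
  have "summable v"
    unfolding v_def using norm_square_less_1 by (intro summable_mult summable_geometric) simp
  then have v: "v summable_on UNIV"
    by (subst summable_on_UNIV_nonneg_real_iff) (auto simp: v_def)
  have nonneg: "u k \<ge> 0" "v k \<ge> 0" for k by (auto simp: u_def v_def)
  have "(\<lambda>(k, m). u k * v m) summable_on (UNIV \<times> UNIV)"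
    using u v nonneg by (intro summable_on_SigmaI[where g = "\<lambda>k. u k * infsum v UNIV"])
      (auto intro: has_sum_cmult_right summable_on_cmult_left)
  then show ?thesis
  proof (rule Infinite_Sum.abs_summable_on_comparison_test')
    fix p :: "nat \<times> nat"
    obtain k m where p: "p = (k, m)" by (cases p)
    have "norm (cauchy_term (q\<^sup>2) (2 * k) m) \<le> v m"
      unfolding v_def
      by (rule norm_cauchy_term_le[OF norm_square_less_1 B]) (simp add: power2_eq_square trans_le_add1)
    then show "norm (double_term q x p) \<le> (case p of (k, m) \<Rightarrow> u k * v m)"
      using nonneg(1)[of k] by (simp add: p double_term_def u_def norm_mult mult_left_mono)
  qed
qed

lemma double_term_row:
  "((\<lambda>m. double_term q x (k, m)) has_sum
     (q ^ (3 * k\<^sup>2) * chebT2 x k * (1 / qpoch_inf (q\<^sup>2) (q\<^sup>2)))) UNIV"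
  unfolding double_term_def prod.case
  by (intro has_sum_cmult_right norm_summable_imp_has_sum summable_norm_cauchy_term
      cauchy_term_sums norm_square_less_1)

text \<open>With n = k + m the exponents agree: 3k^2 + 2(m^2 + 2km) = 2n^2 + k^2.\<close>

lemma double_term_diagonal:
  assumes "k \<le> n"
  shows "double_term q x (k, n - k) = q ^ (2 * n\<^sup>2) * (chebT2 x k * jtp_coeff q n k)"
proof -
  obtain m where n: "n = k + m" using assms by (metis le_iff_add)
  have e: "q ^ (3 * k\<^sup>2) * (q\<^sup>2) ^ (m\<^sup>2 + 2 * k * m) = q ^ (2 * n\<^sup>2) * q ^ k\<^sup>2"
    unfolding power_mult[symmetric] power_add[symmetric]
    by (rule arg_cong[of _ _ "power q"]) (simp add: n power2_eq_square algebra_simps)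
  have "double_term q x (k, n - k) = (q ^ (3 * k\<^sup>2) * (q\<^sup>2) ^ (m\<^sup>2 + 2 * k * m)) * chebT2 x k
      * (1 / qpoch (q\<^sup>2) (q\<^sup>2) m) * (1 / qpoch (q\<^sup>2) (q\<^sup>2) (m + 2 * k))"
    by (simp add: double_term_def cauchy_term_def n mult_ac)
  also have "\<dots> = q ^ (2 * n\<^sup>2) * (chebT2 x k * jtp_coeff q n k)"
    unfolding e by (simp add: jtp_coeff_def n mult_2 add_ac)
  finally show ?thesis .
qed

text \<open>Both sides equal the total \<open>S\<close> of the double series; the form
  \<open>sums\<close> delivers convergence of the left-hand series along with its value.\<close>

lemma lhs_sums_theta:
  "(\<lambda>n. q ^ (2 * n\<^sup>2) * (\<Prod>j=1..n. 1 + 2 * x * q ^ (2 * j - 1) + q ^ (4 * j - 2))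
      / qpoch (q\<^sup>2) (q\<^sup>2) (2 * n)) sums
   (1 / qpoch_inf (q\<^sup>2) (q\<^sup>2) * (\<Sum>n. q ^ (3 * n\<^sup>2) * chebT2 x n))"
proof -
  obtain S where S: "(double_term q x has_sum S) (UNIV \<times> UNIV)"
    using abs_summable_summable[OF abs_summable_double_term] by (auto simp: summable_on_def)
  have "((\<lambda>k. q ^ (3 * k\<^sup>2) * chebT2 x k * (1 / qpoch_inf (q\<^sup>2) (q\<^sup>2))) has_sum S) UNIV"
    using S double_term_row by (rule has_sum_SigmaD)
  then have "(\<lambda>k. q ^ (3 * k\<^sup>2) * chebT2 x k * (1 / qpoch_inf (q\<^sup>2) (q\<^sup>2))) sums S"
    by (rule has_sum_imp_sums)
  moreover have "(\<lambda>k. q ^ (3 * k\<^sup>2) * chebT2 x k * (1 / qpoch_inf (q\<^sup>2) (q\<^sup>2))) sums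
      ((\<Sum>n. q ^ (3 * n\<^sup>2) * chebT2 x n) * (1 / qpoch_inf (q\<^sup>2) (q\<^sup>2)))"
    by (intro sums_mult2 summable_sums summable_norm_cancel[OF summable_norm_theta])
  ultimately have S_eq: "S = 1 / qpoch_inf (q\<^sup>2) (q\<^sup>2) * (\<Sum>n. q ^ (3 * n\<^sup>2) * chebT2 x n)"
    unfolding mult.commute[of "1 / qpoch_inf (q\<^sup>2) (q\<^sup>2)"] by (rule sums_unique2)
  \<comment> \<open>Pairs (k, m) correspond to pairs (n, k) with k \<le> n through n = k + m, so the
    new rows are finite antidiagonals.\<close>
  have "((\<lambda>(n, k). double_term q x (k, n - k)) has_sum S) (Sigma UNIV (\<lambda>n. {..n})) \<longleftrightarrow>
      (double_term q x has_sum S) (UNIV \<times> UNIV)"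
    by (rule has_sum_reindex_bij_witness[where i = "\<lambda>(k, m). (k + m, k)" and j = "\<lambda>(n, k). (k, n - k)"])
      auto
  then have "((\<lambda>(n, k). double_term q x (k, n - k)) has_sum S) (Sigma UNIV (\<lambda>n. {..n}))"
    using S by simp
  then have "((\<lambda>n. \<Sum>k\<le>n. double_term q x (k, n - k)) has_sum S) UNIV"
    by (rule has_sum_SigmaD) simp
  then have "(\<lambda>n. \<Sum>k\<le>n. double_term q x (k, n - k)) sums S"
    by (rule has_sum_imp_sums)
  moreover have "(\<Sum>k\<le>n. double_term q x (k, n - k)) =
      q ^ (2 * n\<^sup>2) * (\<Prod>j=1..n. 1 + 2 * x * q ^ (2 * j - 1) + q ^ (4 * j - 2))
      / qpoch (q\<^sup>2) (q\<^sup>2) (2 * n)" for n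
    unfolding times_divide_eq_right[symmetric] finite_jacobi_triple_product sum_distrib_left
    by (intro sum.cong refl double_term_diagonal) auto
  ultimately show ?thesis
    by (simp only: S_eq)
qed

end

theorem theorem1p1:
  fixes q x :: complex
  assumes "norm q < 1"
  shows "summable (\<lambda>n::nat. q ^ (2 * n\<^sup>2) * (\<Prod>j=1..n. 1 + 2 * x * q ^ (2 * j - 1) + q ^ (4 * j - 2))
            / qpoch (q\<^sup>2) (q\<^sup>2) (2 * n)) \<and>
         summable (\<lambda>n::nat. q ^ (3 * n\<^sup>2) * (poly (chebV (int n)) x + poly (chebV (int n - 1)) x)) \<and>
         (\<Sum>n::nat. q ^ (2 * n\<^sup>2) * (\<Prod>j=1..n. 1 + 2 * x * q ^ (2 * j - 1) + q ^ (4 * j - 2))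
            / qpoch (q\<^sup>2) (q\<^sup>2) (2 * n))
         = 1 / qpoch_inf (q\<^sup>2) (q\<^sup>2)
           * (\<Sum>n::nat. q ^ (3 * n\<^sup>2) * (poly (chebV (int n)) x + poly (chebV (int n - 1)) x))"
  unfolding chebT2_def[symmetric]
  using lhs_sums_theta[OF assms] summable_norm_cancel[OF summable_norm_theta[OF assms]]
  by (auto simp: sums_iff)

end
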